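(* Let $G_1$ and $G_2$ be coperfectly Hopfian groups such that $G_1$ is normally incommensurable with $G_2$. Then $G_1\times G_2$ is coperfectly Hopfian.
   Context: A group $G$ is coperfectly Hopfian if every homomorphism $\varphi:G\to G$ with $\varphi(G)\unlhd G$ and $G/\varphi(G)$ perfect is an automorphism. A group $G$ is normally incommensurable with a group $H$ if there is no nontrivial homomorphism $f:G\to H$ such that $f(G)\unlhd K\unlhd H$ for some normal subgroup $K$ of $H$. *)

theory Defs
  imports "HOL-Algebra.Algebra"
begin

definition perfect_group :: "('a, 'b) monoid_scheme \<Rightarrow> bool" where
  "perfect_group G \<longleftrightarrow> group G \<and> derived G (carrier G) = carrier G"

(* Functions in hom G G and iso G G are unconstrained outside carrier G, so iso G G is used
   for the automorphisms rather than auto G, whose elements must be extensional. *)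
definition coperfectly_hopfian :: "('a, 'b) monoid_scheme \<Rightarrow> bool" where
  "coperfectly_hopfian G \<longleftrightarrow> group G \<and>
     (\<forall>\<phi> \<in> hom G G.
        \<phi> ` carrier G \<lhd> G \<longrightarrow> perfect_group (G Mod (\<phi> ` carrier G)) \<longrightarrow> \<phi> \<in> iso G G)"

definition normally_incommensurable ::
    "('a, 'c) monoid_scheme \<Rightarrow> ('b, 'd) monoid_scheme \<Rightarrow> bool" where
  "normally_incommensurable G H \<longleftrightarrow> group G \<and> group H \<and>
     \<not> (\<exists>f \<in> hom G H. \<not> trivial_homomorphism G H f \<and>
          (\<exists>K. K \<lhd> H \<and> f ` carrier G \<lhd> H\<lparr>carrier := K\<rparr>))"

end

theory Submission
  imports Defs
begin

text \<open>
  Let \<open>\<phi>\<close> be an endomorphism of \<open>G1 \<times>\<times> G2\<close> with normal image \<open>N\<close> and perfect cokernel.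
  The homomorphism \<open>x \<mapsto> snd (\<phi> (x, 1))\<close> sends \<open>G1\<close> onto a normal subgroup of the projection
  of \<open>N\<close> to \<open>G2\<close>, and that projection is normal in \<open>G2\<close>. Normal incommensurability
  therefore makes this map trivial, so \<open>\<phi>\<close> has the triangular form
  \<open>\<phi> (x, y) = (f x \<cdot> k y, g y)\<close>, and it remains to see that the diagonal entries \<open>f\<close> and \<open>g\<close>
  are automorphisms, which is decided by their cokernels.

  The image of \<open>g\<close> is the projection of \<open>N\<close>, so the cokernel of \<open>g\<close> is a quotient of the
  cokernel of \<open>\<phi>\<close>, hence perfect, and \<open>g\<close> is an automorphism because \<open>G2\<close> is
  coperfectly Hopfian. Now both halves of the bijectivity of \<open>g\<close> serve to
  compare the cokernels of \<open>f\<close> and \<open>\<phi>\<close>. Injectivity shows that \<open>N\<close> meets the first factor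
  exactly in the image of \<open>f\<close>, and surjectivity shows that \<open>N\<close> and the first factor
  generate the whole product. By the isomorphism theorems the image of \<open>f\<close> is normal in
  \<open>G1\<close> and the two cokernels are isomorphic, so \<open>f\<close> is an automorphism as well.
\<close>

lemma perfect_group_epimorphic_image:
  assumes "group_hom G H h" and onto: "h ` carrier G = carrier H" and perf: "perfect_group G"
  shows "perfect_group H"
proof -
  interpret group_hom G H h by fact
  have "derived H (carrier H) = h ` derived G (carrier G)"
    using derived_img[of "carrier G"] onto by simp
  then show ?thesis
    using perf onto H.is_group by (simp add: perfect_group_def)
qed

text \<open>\<open>h\<close> induces an epimorphism from \<open>G Mod N\<close> onto \<open>H Mod (h ` N)\<close>.\<close>

lemma perfect_quotient_by_image:
  assumes "group_hom G H h" and onto: "h ` carrier G = carrier H" and "N \<lhd> G"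
    and perf: "perfect_group (G Mod N)"
  shows "perfect_group (H Mod (h ` N))"
proof -
  interpret group_hom G H h by fact
  interpret N: normal N G by fact
  interpret M: normal "h ` N" H
    by (rule N.surj_hom_normal_subgroup[OF group_hom_axioms onto])
  let ?q = "\<lambda>x. h ` N #>\<^bsub>H\<^esub> h x"
  have q: "?q \<in> hom G (H Mod (h ` N))"
    using Group.hom_compose[OF homh M.r_coset_hom_Mod] by (simp add: o_def)
  have q_cong: "?q x = ?q y"
    if x: "x \<in> carrier G" and y: "y \<in> carrier G" and eq: "N #>\<^bsub>G\<^esub> x = N #>\<^bsub>G\<^esub> y" for x y
  proof -
    have "x \<in> N #>\<^bsub>G\<^esub> y"
      using G.rcos_self[OF x N.subgroup_axioms] eq by simp
    then obtain n where n: "n \<in> N" "x = n \<otimes>\<^bsub>G\<^esub> y"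
      by (auto simp: r_coset_def)
    then have "h x \<in> h ` N #>\<^bsub>H\<^esub> h y"
      using y N.subset by (auto simp: r_coset_def)
    then show ?thesis
      using H.repr_independence[of "h x" "h ` N" "h y"] y M.subgroup_axioms by simp
  qed
  obtain g where g: "g \<in> hom (G Mod N) (H Mod (h ` N))"
    and gq: "\<And>x. x \<in> carrier G \<Longrightarrow> g (N #>\<^bsub>G\<^esub> x) = ?q x"
    using FactGroup_universal[OF q \<open>N \<lhd> G\<close> q_cong] by blast
  have "group_hom (G Mod N) (H Mod (h ` N)) g"
    using g N.factorgroup_is_group M.factorgroup_is_group
    by (simp add: group_hom_def group_hom_axioms_def)
  moreover have "g ` carrier (G Mod N) = carrier (H Mod (h ` N))"
    by (simp add: carrier_FactGroup image_image gq flip: onto)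
  ultimately show ?thesis
    using perf by (rule perfect_group_epimorphic_image)
qed

lemma
  assumes "group_hom G H j" and "N \<lhd> H"
  shows hom_to_quotient: "group_hom G (H Mod N) (\<lambda>x. N #>\<^bsub>H\<^esub> j x)"
    and kernel_hom_to_quotient: "kernel G (H Mod N) (\<lambda>x. N #>\<^bsub>H\<^esub> j x) = {x \<in> carrier G. j x \<in> N}"
proof -
  interpret group_hom G H j by fact
  interpret N: normal N H by fact
  let ?q = "\<lambda>x. N #>\<^bsub>H\<^esub> j x"
  have "?q \<in> hom G (H Mod N)"
    using Group.hom_compose[OF homh N.r_coset_hom_Mod] by (simp add: o_def)
  then show "group_hom G (H Mod N) ?q"
    using N.factorgroup_is_group by (simp add: group_hom_def group_hom_axioms_def)
  show "kernel G (H Mod N) ?q = {x \<in> carrier G. j x \<in> N}"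
    using H.coset_join1[OF _ _ N.subgroup_axioms] H.coset_join2[OF _ N.subgroup_axioms]
    by (auto simp: kernel_def)
qed

lemma normal_preimage:
  assumes "group_hom G H j" and "N \<lhd> H"
  shows "{x \<in> carrier G. j x \<in> N} \<lhd> G"
  using group_hom.normal_kernel[OF hom_to_quotient[OF assms]] kernel_hom_to_quotient[OF assms]
  by simp

text \<open>The second isomorphism theorem in a form where the subgroup is the image of an arbitrary
  homomorphism \<open>j\<close>: if \<open>N\<close> and that image generate \<open>H\<close>, then \<open>j\<close> followed by the quotient
  map is still onto, and its kernel is the preimage of \<open>N\<close>.\<close>

lemma quotient_by_preimage_iso:
  assumes "group_hom G H j" and "N \<lhd> H"
    and cover: "\<And>h. h \<in> carrier H \<Longrightarrow> \<exists>n\<in>N. \<exists>x\<in>carrier G. h = n \<otimes>\<^bsub>H\<^esub> j x"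
  shows "G Mod {x \<in> carrier G. j x \<in> N} \<cong> H Mod N"
proof -
  interpret group_hom G H j by fact
  interpret N: normal N H by fact
  let ?q = "\<lambda>x. N #>\<^bsub>H\<^esub> j x"
  interpret q: group_hom G "H Mod N" ?q
    by (rule hom_to_quotient[OF assms(1,2)])
  have "N #>\<^bsub>H\<^esub> h \<in> ?q ` carrier G" if "h \<in> carrier H" for h
  proof -
    obtain n x where nx: "n \<in> N" "x \<in> carrier G" "h = n \<otimes>\<^bsub>H\<^esub> j x"
      using cover[OF \<open>h \<in> carrier H\<close>] by blast
    then have "N #>\<^bsub>H\<^esub> h = ?q x"
      using N.subset H.coset_mult_assoc[of N n "j x"] H.coset_join2[OF _ N.subgroup_axioms, of n]
      by auto
    then show ?thesis
      using nx(2) by blast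
  qed
  then have "?q ` carrier G = carrier (H Mod N)"
    by (auto simp: carrier_FactGroup)
  then show ?thesis
    using q.FactGroup_iso kernel_hom_to_quotient[OF assms(1,2)] by simp
qed

lemma perfect_group_iso:
  assumes "G \<cong> H" and "group G" and "perfect_group H"
  shows "perfect_group G"
proof -
  obtain h where "h \<in> iso H G"
    using group.iso_sym[OF \<open>group G\<close> \<open>G \<cong> H\<close>] by (auto simp: is_iso_def)
  then show ?thesis
    using assms perfect_group_epimorphic_image[of H G h]
    by (simp add: iso_iff group_hom_def group_hom_axioms_def perfect_group_def)
qed

lemma coperfectly_hopfianD:
  assumes "coperfectly_hopfian G" and "\<phi> \<in> hom G G"
    and "\<phi> ` carrier G \<lhd> G" and "perfect_group (G Mod (\<phi> ` carrier G))"
  shows "\<phi> \<in> iso G G"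
  using assms by (simp add: coperfectly_hopfian_def)

lemma triangular_endomorphism_iso:
  assumes "group G1" and "group G2"
    and \<phi>: "\<phi> \<in> hom (G1 \<times>\<times> G2) (G1 \<times>\<times> G2)"
    and tri: "\<And>x y. x \<in> carrier G1 \<Longrightarrow> y \<in> carrier G2 \<Longrightarrow> \<phi> (x, y) = (f x \<otimes>\<^bsub>G1\<^esub> k y, g y)"
    and k: "k \<in> hom G2 G1" and f: "f \<in> iso G1 G1" and g: "g \<in> iso G2 G2"
  shows "\<phi> \<in> iso (G1 \<times>\<times> G2) (G1 \<times>\<times> G2)"
proof -
  interpret G1: group G1 by fact
  interpret G2: group G2 by fact
  interpret k: group_hom G2 G1 k
    using k by unfold_locales
  interpret f: group_hom G1 G1 f
    using f by unfold_locales (simp add: iso_iff)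
  interpret g: group_hom G2 G2 g
    using g by unfold_locales (simp add: iso_iff)
  interpret \<phi>: group_hom "G1 \<times>\<times> G2" "G1 \<times>\<times> G2" \<phi>
    using \<phi> DirProd_group[OF assms(1,2)] by (simp add: group_hom_def group_hom_axioms_def)
  have pair_in_image: "(a, b) \<in> \<phi> ` carrier (G1 \<times>\<times> G2)" if a: "a \<in> carrier G1" and b: "b \<in> carrier G2" for a b
  proof -
    obtain y where y: "y \<in> carrier G2" "g y = b"
      using g b unfolding iso_iff by (metis imageE)
    have "a \<otimes>\<^bsub>G1\<^esub> inv\<^bsub>G1\<^esub> k y \<in> carrier G1"
      using a y by simp
    then obtain x where x: "x \<in> carrier G1" "f x = a \<otimes>\<^bsub>G1\<^esub> inv\<^bsub>G1\<^esub> k y"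
      using f unfolding iso_iff by (metis imageE)
    have "\<phi> (x, y) = (a, b)"
      using x y a tri by (simp add: G1.m_assoc)
    moreover have "(x, y) \<in> carrier (G1 \<times>\<times> G2)"
      using x y by simp
    ultimately show ?thesis
      by (metis image_eqI)
  qed
  have ker: "p = \<one>\<^bsub>G1 \<times>\<times> G2\<^esub>" if p_in: "p \<in> carrier (G1 \<times>\<times> G2)" and p_ker: "\<phi> p = \<one>\<^bsub>G1 \<times>\<times> G2\<^esub>" for p
  proof -
    obtain x y where p: "p = (x, y)" "x \<in> carrier G1" "y \<in> carrier G2"
      using p_in by auto
    have "g y = \<one>\<^bsub>G2\<^esub>"
      using p_ker p tri by simp
    then have y: "y = \<one>\<^bsub>G2\<^esub>"
      using g p g.iso_iff by blast
    then have "f x = \<one>\<^bsub>G1\<^esub>"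
      using p_ker p tri by simp
    then have "x = \<one>\<^bsub>G1\<^esub>"
      using f p f.iso_iff by blast
    then show ?thesis
      using p y by simp
  qed
  show ?thesis
    unfolding \<phi>.iso_iff
  proof (intro conjI ballI impI)
    show "carrier (G1 \<times>\<times> G2) \<subseteq> \<phi> ` carrier (G1 \<times>\<times> G2)"
      using pair_in_image by (simp add: subset_iff)
  qed (rule ker)
qed

text \<open>The first factor is normal in the product, so its image is normal in the image of \<open>\<psi>\<close>. This
  puts the restriction of \<open>\<psi>\<close> to \<open>G1\<close> in the scope of normal incommensurability, with the image of
  \<open>\<psi>\<close> as the intermediate normal subgroup.\<close>

lemma off_diagonal_trivial:
  assumes incomm: "normally_incommensurable G1 G2"
    and \<psi>: "\<psi> \<in> hom (G1 \<times>\<times> G2) G2"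
    and img: "\<psi> ` carrier (G1 \<times>\<times> G2) \<lhd> G2"
    and x: "x \<in> carrier G1"
  shows "\<psi> (x, \<one>\<^bsub>G2\<^esub>) = \<one>\<^bsub>G2\<^esub>"
proof -
  interpret G1: group G1
    using incomm by (simp add: normally_incommensurable_def)
  interpret G2: group G2
    using incomm by (simp add: normally_incommensurable_def)
  have grp: "group (G1 \<times>\<times> G2)"
    by (rule DirProd_group) unfold_locales
  let ?K = "\<psi> ` carrier (G1 \<times>\<times> G2)"
  let ?e = "\<lambda>x. \<psi> (x, \<one>\<^bsub>G2\<^esub>)"
  interpret K: normal ?K G2 by fact
  have fst_fact: "carrier G1 \<times> {\<one>\<^bsub>G2\<^esub>} \<lhd> G1 \<times>\<times> G2"
    using G1.DirProd_normal[OF G2.is_group G1.normal_self G2.one_is_normal] .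
  have "group_hom (G1 \<times>\<times> G2) (G2\<lparr>carrier := ?K\<rparr>) \<psi>"
    using \<psi> grp G2.subgroup_imp_group[OF K.subgroup_axioms]
    by (auto simp: group_hom_def group_hom_axioms_def hom_def)
  then have "\<psi> ` (carrier G1 \<times> {\<one>\<^bsub>G2\<^esub>}) \<lhd> G2\<lparr>carrier := ?K\<rparr>"
    by (rule normal.surj_hom_normal_subgroup[OF fst_fact]) simp
  moreover have "\<psi> ` (carrier G1 \<times> {\<one>\<^bsub>G2\<^esub>}) = ?e ` carrier G1"
    by auto
  moreover have "(\<lambda>x. (x, \<one>\<^bsub>G2\<^esub>)) \<in> hom G1 (G1 \<times>\<times> G2)"
    by (auto simp: hom_def)
  then have "?e \<in> hom G1 G2"
    using Group.hom_compose[OF _ \<psi>] by (fastforce simp: o_def)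
  ultimately have "trivial_homomorphism G1 G2 ?e"
    using incomm img unfolding normally_incommensurable_def by metis
  then show ?thesis
    using x by (simp add: trivial_homomorphism_def)
qed

theorem theorem4p5:
  fixes G1 :: "('a, 'c) monoid_scheme" and G2 :: "('b, 'd) monoid_scheme"
  assumes "coperfectly_hopfian G1"
    and "coperfectly_hopfian G2"
    and "normally_incommensurable G1 G2"
  shows "coperfectly_hopfian (G1 \<times>\<times> G2)"
proof -
  interpret G1: group G1
    using assms(1) by (simp add: coperfectly_hopfian_def)
  interpret G2: group G2
    using assms(2) by (simp add: coperfectly_hopfian_def)
  let ?G = "G1 \<times>\<times> G2"
  interpret G: group ?G
    by (rule DirProd_group) unfold_locales
  have inl: "(\<lambda>x. (x, \<one>\<^bsub>G2\<^esub>)) \<in> hom G1 ?G" and inr: "(\<lambda>y. (\<one>\<^bsub>G1\<^esub>, y)) \<in> hom G2 ?G"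
    by (auto simp: hom_def)
  have inl_grp: "group_hom G1 ?G (\<lambda>x. (x, \<one>\<^bsub>G2\<^esub>))"
    using inl by unfold_locales
  have proj: "group_hom ?G G2 snd" "snd ` carrier ?G = carrier G2"
    using G1.one_closed by unfold_locales (auto simp: hom_def image_iff)
  have "\<phi> \<in> iso ?G ?G"
    if \<phi>: "\<phi> \<in> hom ?G ?G" and N: "\<phi> ` carrier ?G \<lhd> ?G"
      and perf: "perfect_group (?G Mod (\<phi> ` carrier ?G))" for \<phi>
  proof -
    interpret \<phi>: group_hom ?G ?G \<phi>
      using \<phi> by unfold_locales
    let ?N = "\<phi> ` carrier ?G"
    define f where "f \<equiv> \<lambda>x. fst (\<phi> (x, \<one>\<^bsub>G2\<^esub>))"
    define k where "k \<equiv> \<lambda>y. fst (\<phi> (\<one>\<^bsub>G1\<^esub>, y))"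
    define g where "g \<equiv> \<lambda>y. snd (\<phi> (\<one>\<^bsub>G1\<^esub>, y))"
    have homs: "fst \<circ> \<phi> \<in> hom ?G G1" "snd \<circ> \<phi> \<in> hom ?G G2"
      using \<phi> by (simp_all add: hom_pairwise)
    have f: "f \<in> hom G1 G1"
      using Group.hom_compose[OF inl homs(1)] by (simp add: f_def o_def)
    have k: "k \<in> hom G2 G1"
      using Group.hom_compose[OF inr homs(1)] by (simp add: k_def o_def)
    have g: "g \<in> hom G2 G2"
      using Group.hom_compose[OF inr homs(2)] by (simp add: g_def o_def)
    interpret k: group_hom G2 G1 k
      using k by unfold_locales
    interpret f: group_hom G1 G1 f
      using f by unfold_locales
    interpret g: group_hom G2 G2 g
      using g by unfold_locales

    have projN: "snd ` ?N \<lhd> G2"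
      using normal.surj_hom_normal_subgroup[OF N proj] .
    have off: "snd (\<phi> (x, \<one>\<^bsub>G2\<^esub>)) = \<one>\<^bsub>G2\<^esub>" if "x \<in> carrier G1" for x
      using off_diagonal_trivial[OF assms(3) homs(2) _ that] projN by (simp add: image_comp)
    have tri: "\<phi> (x, y) = (f x \<otimes>\<^bsub>G1\<^esub> k y, g y)" if "x \<in> carrier G1" "y \<in> carrier G2" for x y
    proof -
      have "(x, y) = (x, \<one>\<^bsub>G2\<^esub>) \<otimes>\<^bsub>?G\<^esub> (\<one>\<^bsub>G1\<^esub>, y)"
        using that by simp
      then have "\<phi> (x, y) = \<phi> (x, \<one>\<^bsub>G2\<^esub>) \<otimes>\<^bsub>?G\<^esub> \<phi> (\<one>\<^bsub>G1\<^esub>, y)"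
        using that \<phi>.hom_mult[of "(x, \<one>\<^bsub>G2\<^esub>)" "(\<one>\<^bsub>G1\<^esub>, y)"] by simp
      also have "\<dots> = (f x \<otimes>\<^bsub>G1\<^esub> k y, \<one>\<^bsub>G2\<^esub> \<otimes>\<^bsub>G2\<^esub> g y)"
        using off[OF that(1)] by (simp add: mult_DirProd' f_def k_def g_def)
      finally show ?thesis
        using that by simp
    qed

    have "snd ` ?N = g ` carrier G2"
      using G1.one_closed by (force simp: tri image_iff)
    then have g_iso: "g \<in> iso G2 G2"
      using coperfectly_hopfianD[OF assms(2) g] projN
        perfect_quotient_by_image[OF proj N perf] by simp

    \<comment> \<open>Injectivity of \<open>g\<close>: an element of \<open>?N\<close> with trivial second entry comes from some \<open>(x', 1)\<close>.\<close>
    have preimage: "{x \<in> carrier G1. (x, \<one>\<^bsub>G2\<^esub>) \<in> ?N} = f ` carrier G1"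
    proof (intro equalityI subsetI)
      fix x assume "x \<in> {x \<in> carrier G1. (x, \<one>\<^bsub>G2\<^esub>) \<in> ?N}"
      then obtain x' y where xy: "x' \<in> carrier G1" "y \<in> carrier G2" "(x, \<one>\<^bsub>G2\<^esub>) = \<phi> (x', y)"
        by auto
      then have "g y = \<one>\<^bsub>G2\<^esub>"
        by (simp add: tri)
      then have "y = \<one>\<^bsub>G2\<^esub>"
        using g_iso xy g.iso_iff by blast
      then show "x \<in> f ` carrier G1"
        using xy by (simp add: tri)
    next
      fix x assume "x \<in> f ` carrier G1"
      then obtain x' where x': "x' \<in> carrier G1" "x = f x'"
        by auto
      then have "(x, \<one>\<^bsub>G2\<^esub>) = \<phi> (x', \<one>\<^bsub>G2\<^esub>)"
        by (simp add: tri)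
      then show "x \<in> {x \<in> carrier G1. (x, \<one>\<^bsub>G2\<^esub>) \<in> ?N}"
        using x' by auto
    qed
    \<comment> \<open>Surjectivity of \<open>g\<close>: the second entry of \<open>h\<close> can be matched inside \<open>?N\<close>.\<close>
    have cover: "\<exists>n\<in>?N. \<exists>x\<in>carrier G1. h = n \<otimes>\<^bsub>?G\<^esub> (x, \<one>\<^bsub>G2\<^esub>)" if "h \<in> carrier ?G" for h
    proof -
      obtain a b where h: "h = (a, b)" "a \<in> carrier G1" "b \<in> carrier G2"
        using \<open>h \<in> carrier ?G\<close> by auto
      obtain y where y: "y \<in> carrier G2" "g y = b"
        using g_iso h(3) unfolding iso_iff by (metis imageE)
      have "h = \<phi> (\<one>\<^bsub>G1\<^esub>, y) \<otimes>\<^bsub>?G\<^esub> (inv\<^bsub>G1\<^esub> k y \<otimes>\<^bsub>G1\<^esub> a, \<one>\<^bsub>G2\<^esub>)"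
        using h y by (simp add: tri flip: G1.m_assoc)
      moreover have "\<phi> (\<one>\<^bsub>G1\<^esub>, y) \<in> ?N" "inv\<^bsub>G1\<^esub> k y \<otimes>\<^bsub>G1\<^esub> a \<in> carrier G1"
        using h y by auto
      ultimately show ?thesis
        by blast
    qed
    have f_normal: "f ` carrier G1 \<lhd> G1"
      using normal_preimage[OF inl_grp N] preimage by simp
    have "G1 Mod (f ` carrier G1) \<cong> ?G Mod ?N"
      using quotient_by_preimage_iso[OF inl_grp N cover] preimage by simp
    then have "perfect_group (G1 Mod (f ` carrier G1))"
      using perfect_group_iso normal.factorgroup_is_group[OF f_normal] perf by blast
    then have "f \<in> iso G1 G1"
      using coperfectly_hopfianD[OF assms(1) f f_normal] by simp
    then show ?thesis
      using triangular_endomorphism_iso[OF G1.is_group G2.is_group \<phi> tri k _ g_iso] by blast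
  qed
  then show ?thesis
    using G.is_group by (simp add: coperfectly_hopfian_def)
qed

end
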